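(* Let $n\ge 1$ and let $T_n$ be the semigroup, under composition, of all maps from $X_n=\{1,2,\dots,n\}$ to itself. Then $T_n$ has a permutation matching; that is, there is a bijection $f:T_n\to T_n$ such that $f(\alpha)$ is an inverse of $\alpha$ for every $\alpha\in T_n$.
   Context: In a semigroup $S$, an element $v$ is an inverse of $u$ if $uvu=u$ and $vuv=v$. A permutation matching of $S$ is a permutation $f$ of the set $S$ such that $f(a)$ is an inverse of $a$ for all $a\in S$. *)

theory Defs
  imports Main "HOL-Library.FuncSet"
begin

text \<open>A semigroup is given by its carrier \<open>S\<close> and its multiplication \<open>mul\<close>, of which only
  the values on \<open>S\<close> matter.\<close>

definition semigroup_on :: "'a set \<Rightarrow> ('a \<Rightarrow> 'a \<Rightarrow> 'a) \<Rightarrow> bool" where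
  "semigroup_on S mul \<longleftrightarrow>
     (\<forall>a\<in>S. \<forall>b\<in>S. mul a b \<in> S) \<and>
     (\<forall>a\<in>S. \<forall>b\<in>S. \<forall>c\<in>S. mul (mul a b) c = mul a (mul b c))"

definition inverse_of :: "'a set \<Rightarrow> ('a \<Rightarrow> 'a \<Rightarrow> 'a) \<Rightarrow> 'a \<Rightarrow> 'a \<Rightarrow> bool" where
  "inverse_of S mul v u \<longleftrightarrow>
     u \<in> S \<and> v \<in> S \<and> mul (mul u v) u = u \<and> mul (mul v u) v = v"

definition permutation_matching :: "'a set \<Rightarrow> ('a \<Rightarrow> 'a \<Rightarrow> 'a) \<Rightarrow> ('a \<Rightarrow> 'a) \<Rightarrow> bool" where
  "permutation_matching S mul f \<longleftrightarrow>
     bij_betw f S S \<and> (\<forall>a\<in>S. inverse_of S mul (f a) a)"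

text \<open>The maps from \<open>{1..n}\<close> to itself are the functions on \<open>nat\<close> that send \<open>{1..n}\<close> into itself
  and are \<open>undefined\<close> outside, so that equality is equality on \<open>{1..n}\<close>.\<close>

definition full_transformations :: "nat \<Rightarrow> (nat \<Rightarrow> nat) set" where
  "full_transformations n = {1..n} \<rightarrow>\<^sub>E {1..n}"

definition transformation_mult :: "nat \<Rightarrow> (nat \<Rightarrow> nat) \<Rightarrow> (nat \<Rightarrow> nat) \<Rightarrow> nat \<Rightarrow> nat" where
  "transformation_mult n = compose {1..n}"

lemma semigroup_full_transformations:
  "semigroup_on (full_transformations n) (transformation_mult n)"
  unfolding semigroup_on_def full_transformations_def transformation_mult_def
  by (auto simp: compose_def PiE_iff extensional_def restrict_def fun_eq_iff)

end

theory Submission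
  imports Defs Complex_Main
begin

text \<open>
  Let \<open>p \<alpha>\<close> be the number of transversals of the kernel of \<open>\<alpha>\<close>, i.e. the product of the sizes of
  its kernel classes. Give each pair \<open>(\<alpha>, \<beta>)\<close> of mutually inverse maps the weight
  \<open>1 / (p \<alpha> * p \<beta>)\<close>. Sorting the inverses \<open>\<beta>\<close> of \<open>\<alpha>\<close> by their image, which is
  one of the \<open>p \<alpha>\<close> transversals \<open>B\<close>, the sum of \<open>1 / p \<beta>\<close> over the inverses with image \<open>B\<close>
  depends only on the size of \<open>B\<close>, because permutations of the ground set act transitively on such
  configurations and preserve \<open>p\<close>. So the weights at \<open>\<alpha>\<close> add up to a positive number which depends
  only on the rank of \<open>\<alpha>\<close>. Inverse maps have equal rank, so after normalisation the weights form a
  symmetric doubly stochastic matrix, and Hall's theorem gives a permutation inside its support.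
\<close>

section \<open>Hall's theorem and doubly stochastic weights\<close>

text \<open>Induction on \<open>S\<close>. If some nonempty proper subset \<open>A\<close> has
  exactly \<open>card A\<close> neighbours, then \<open>A\<close> is matched into them and the rest
  of \<open>S\<close> outside them. Otherwise every such subset has a spare neighbour, so one pair
  can be matched freely and removed.\<close>

theorem hall_marriage:
  assumes "finite S" "\<And>a. a \<in> S \<Longrightarrow> finite (N a)"
    and "\<And>A. A \<subseteq> S \<Longrightarrow> card A \<le> card (\<Union>(N ` A))"
  shows "\<exists>f. inj_on f S \<and> (\<forall>a\<in>S. f a \<in> N a)"
  using assms
proof (induction S arbitrary: N rule: finite_psubset_induct)
  case (psubset S)
  consider "S = {}"
    | (tight) A where "A \<subset> S" "A \<noteq> {}" "card (\<Union>(N ` A)) = card A"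
    | (slack) "S \<noteq> {}" "\<And>A. A \<subset> S \<Longrightarrow> A \<noteq> {} \<Longrightarrow> card A < card (\<Union>(N ` A))"
    using psubset.prems(2) by (metis order_le_less psubset_imp_subset)
  then show ?case
  proof cases
    case 1
    then show ?thesis by simp
  next
    case tight
    let ?M = "\<Union>(N ` A)"
    have "\<exists>f. inj_on f A \<and> (\<forall>a\<in>A. f a \<in> N a)"
      using tight(1) psubset.prems by (intro psubset.IH) auto
    then obtain f where f: "inj_on f A" "\<And>a. a \<in> A \<Longrightarrow> f a \<in> N a" by blast
    have "\<exists>g. inj_on g (S - A) \<and> (\<forall>a\<in>S - A. g a \<in> N a - ?M)"
    proof (rule psubset.IH)
      show "S - A \<subset> S" using tight by blast
      show "finite (N a - ?M)" if "a \<in> S - A" for a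
        using that psubset.prems(1) by auto
      fix C assume C: "C \<subseteq> S - A"
      have finCA: "finite C" "finite A"
        using C tight(1) psubset.hyps by (auto intro: finite_subset)
      \<comment> \<open>Hall's condition for \<open>C \<union> A\<close> is used: discarding
        \<open>?M\<close> loses at most \<open>card A\<close> neighbours, which cancels the
        contribution of \<open>A\<close>.\<close>
      have "card C + card A = card (C \<union> A)"
        using C finCA by (subst card_Un_disjoint) auto
      also have "\<dots> \<le> card (\<Union>(N ` (C \<union> A)))"
        using C tight(1) by (intro psubset.prems(2)) auto
      also have "\<Union>(N ` (C \<union> A)) = (\<Union>a\<in>C. N a - ?M) \<union> ?M" by auto
      also have "card \<dots> \<le> card (\<Union>a\<in>C. N a - ?M) + card A"
        using card_Un_le tight(3) by metis
      finally show "card C \<le> card (\<Union>a\<in>C. N a - ?M)" by simp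
    qed
    then obtain g where g: "inj_on g (S - A)" "\<And>a. a \<in> S - A \<Longrightarrow> g a \<in> N a - ?M" by blast
    let ?h = "\<lambda>a. if a \<in> A then f a else g a"
    have "f ` A \<subseteq> ?M" "g ` (S - A) \<inter> ?M = {}" using f(2) g(2) by auto
    then have "f ` A \<inter> g ` (S - A) = {}" by blast
    then have "inj_on ?h (A \<union> (S - A))" by (rule inj_on_disjoint_Un[OF f(1) g(1)])
    then have "inj_on ?h S" using tight(1) by (simp add: Un_absorb1 psubset_imp_subset)
    moreover have "\<forall>a\<in>S. ?h a \<in> N a" using f g by auto
    ultimately show ?thesis by (intro exI[of _ ?h]) blast
  next
    case slack
    then obtain a where a: "a \<in> S" by blast
    have "card {a} \<le> card (N a)" using psubset.prems(2)[of "{a}"] a by simp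
    then obtain b where b: "b \<in> N a" by fastforce
    have "\<exists>g. inj_on g (S - {a}) \<and> (\<forall>x\<in>S - {a}. g x \<in> N x - {b})"
    proof (rule psubset.IH)
      show "S - {a} \<subset> S" using a by blast
      show "finite (N x - {b})" if "x \<in> S - {a}" for x
        using that psubset.prems(1) by auto
      fix C assume C: "C \<subseteq> S - {a}"
      show "card C \<le> card (\<Union>x\<in>C. N x - {b})"
      proof (cases "C = {}")
        case False
        \<comment> \<open>Since \<open>a\<close> is not in \<open>C\<close>, the subset is proper,
          and its strict surplus absorbs the loss of \<open>b\<close>.\<close>
        have "card C < card (\<Union>(N ` C))" using C a False by (intro slack(2)) auto
        moreover have "(\<Union>x\<in>C. N x - {b}) = \<Union>(N ` C) - {b}" by auto
        ultimately show ?thesis using card_Diff1_le[of "\<Union>(N ` C)" b]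
          by (simp add: card_Diff_singleton_if split: if_splits)
      qed simp
    qed
    then obtain g where g: "inj_on g (S - {a})" "\<And>x. x \<in> S - {a} \<Longrightarrow> g x \<in> N x - {b}" by blast
    let ?h = "g(a := b)"
    have "inj_on ?h S"
    proof (rule inj_onI)
      fix x y assume "x \<in> S" "y \<in> S" "?h x = ?h y"
      then show "x = y"
        using g(2)[of x] g(2)[of y] g(1) by (auto simp: inj_on_def split: if_splits)
    qed
    moreover have "\<forall>x\<in>S. ?h x \<in> N x" using b g by auto
    ultimately show ?thesis by blast
  qed
qed

text \<open>Hall's condition comes from counting mass: the rows in \<open>A\<close> carry mass
  \<open>card A\<close>, all of it in the columns of their neighbourhood, and these columns hold in
  total only as much mass as there are columns.\<close>

lemma doubly_stochastic_imp_permutation: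
  fixes w :: "'a \<Rightarrow> 'a \<Rightarrow> real"
  assumes fin: "finite S"
    and nonneg: "\<And>a b. a \<in> S \<Longrightarrow> b \<in> S \<Longrightarrow> 0 \<le> w a b"
    and row: "\<And>a. a \<in> S \<Longrightarrow> (\<Sum>b\<in>S. w a b) = 1"
    and col: "\<And>b. b \<in> S \<Longrightarrow> (\<Sum>a\<in>S. w a b) = 1"
  shows "\<exists>f. bij_betw f S S \<and> (\<forall>a\<in>S. w a (f a) \<noteq> 0)"
proof -
  define N where "N a = {b \<in> S. w a b \<noteq> 0}" for a
  have "\<exists>f. inj_on f S \<and> (\<forall>a\<in>S. f a \<in> N a)"
  proof (rule hall_marriage)
    show "finite S" by (fact fin)
    show "finite (N a)" for a using fin by (simp add: N_def)
    fix A assume A: "A \<subseteq> S"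
    have sub: "\<Union>(N ` A) \<subseteq> S" by (auto simp: N_def)
    have "real (card A) = (\<Sum>a\<in>A. \<Sum>b\<in>S. w a b)"
      using A row by (simp add: subset_iff)
    also have "\<dots> = (\<Sum>a\<in>A. \<Sum>b\<in>\<Union>(N ` A). w a b)"
      using fin sub by (intro sum.cong refl sum.mono_neutral_right) (auto simp: N_def)
    also have "\<dots> = (\<Sum>b\<in>\<Union>(N ` A). \<Sum>a\<in>A. w a b)" by (rule sum.swap)
    also have "\<dots> \<le> (\<Sum>b\<in>\<Union>(N ` A). \<Sum>a\<in>S. w a b)"
      using fin A sub nonneg by (intro sum_mono sum_mono2) auto
    also have "\<dots> = real (card (\<Union>(N ` A)))"
      using sub col by (simp add: subset_iff)
    finally show "card A \<le> card (\<Union>(N ` A))" by simp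
  qed
  then obtain f where f: "inj_on f S" "\<And>a. a \<in> S \<Longrightarrow> f a \<in> N a" by blast
  then have "f ` S \<subseteq> S" by (auto simp: N_def)
  with fin f(1) have "bij_betw f S S" by (simp add: bij_betw_def endo_inj_surj)
  with f(2) show ?thesis by (auto simp: N_def)
qed

section \<open>Inverses in a finite full transformation semigroup\<close>

text \<open>The transversals of the kernel of \<open>\<alpha>\<close>, expressed through the image
  so that the kernel classes never have to be formed.\<close>

definition transversals :: "'a set \<Rightarrow> ('a \<Rightarrow> 'a) \<Rightarrow> 'a set set" where
  "transversals X \<alpha> = {B. B \<subseteq> X \<and> bij_betw \<alpha> B (\<alpha> ` X)}"

text \<open>The map \<open>\<psi>\<close> is kept separate from \<open>\<alpha>\<close> to allow two
  uses: with \<open>\<psi> = \<alpha>\<close> and \<open>B\<close> a transversal these are the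
  inverses of \<open>\<alpha>\<close> with image \<open>B\<close>; with \<open>\<psi> = id\<close>
  and \<open>B\<close> inside \<open>X\<close> they are the idempotents with image \<open>B\<close>,
  a model independent of \<open>\<alpha>\<close>.\<close>

definition left_inverses :: "'a set \<Rightarrow> 'a set \<Rightarrow> ('a \<Rightarrow> 'a) \<Rightarrow> ('a \<Rightarrow> 'a) set" where
  "left_inverses X B \<psi> = {\<beta> \<in> X \<rightarrow>\<^sub>E B. \<forall>b\<in>B. \<beta> (\<psi> b) = b}"

abbreviation inverses :: "'a set \<Rightarrow> ('a \<Rightarrow> 'a) \<Rightarrow> ('a \<Rightarrow> 'a) set" where
  "inverses X \<alpha> \<equiv> {\<beta>. inverse_of (X \<rightarrow>\<^sub>E X) (compose X) \<beta> \<alpha>}"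

lemma inverse_of_commute: "inverse_of S mul v u \<longleftrightarrow> inverse_of S mul u v"
  by (auto simp: inverse_of_def)

lemma inverse_of_transformations_iff:
  "inverse_of (X \<rightarrow>\<^sub>E X) (compose X) \<beta> \<alpha> \<longleftrightarrow>
     \<alpha> \<in> X \<rightarrow>\<^sub>E X \<and> \<beta> \<in> X \<rightarrow>\<^sub>E X \<and> (\<forall>x\<in>X. \<alpha> (\<beta> (\<alpha> x)) = \<alpha> x) \<and> (\<forall>x\<in>X. \<beta> (\<alpha> (\<beta> x)) = \<beta> x)"
proof -
  have "compose X (compose X u v) u = u \<longleftrightarrow> (\<forall>x\<in>X. u (v (u x)) = u x)"
    if "u \<in> X \<rightarrow>\<^sub>E X" "v \<in> X \<rightarrow>\<^sub>E X" for u v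
    using that by (auto simp: fun_eq_iff compose_def restrict_def PiE_iff extensional_def)
  then show ?thesis by (auto simp: inverse_of_def)
qed

lemma finite_transversals: "finite X \<Longrightarrow> finite (transversals X \<alpha>)"
  by (simp add: transversals_def)

lemma transversals_nonempty: "transversals X \<alpha> \<noteq> {}"
proof -
  obtain B where "B \<subseteq> X" "inj_on \<alpha> B" "\<alpha> ` X = \<alpha> ` B"
    using subset_image_inj[of "\<alpha> ` X" \<alpha> X] by auto
  then show ?thesis by (auto simp: transversals_def bij_betw_def)
qed

lemma card_transversals_pos: "finite X \<Longrightarrow> 0 < card (transversals X \<alpha>)"
  by (simp add: card_gt_0_iff finite_transversals transversals_nonempty)

text \<open>Recovers \<open>B\<close> from \<open>\<beta>\<close>, so the families belonging to
  different transversals are disjoint.\<close>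

lemma image_left_inverse:
  assumes "\<psi> ` B \<subseteq> X" "\<beta> \<in> left_inverses X B \<psi>"
  shows "\<beta> ` X = B"
proof
  show "\<beta> ` X \<subseteq> B" using assms(2) by (auto simp: left_inverses_def)
  show "B \<subseteq> \<beta> ` X"
  proof
    fix b assume "b \<in> B"
    then have "b = \<beta> (\<psi> b)" "\<psi> b \<in> X" using assms by (auto simp: left_inverses_def)
    then show "b \<in> \<beta> ` X" by blast
  qed
qed

text \<open>The identity \<open>\<beta> \<alpha> \<beta> = \<beta>\<close> says that
  \<open>\<beta>\<close> undoes \<open>\<alpha>\<close> on the image of \<open>\<beta>\<close>;
  together with \<open>\<alpha> \<beta> \<alpha> = \<alpha>\<close>, it makes that image a
  transversal. Conversely, each point can be replaced by the representative of its kernel class in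
  \<open>B\<close>.\<close>

lemma inverses_eq_UN_left_inverses:
  assumes "\<alpha> \<in> X \<rightarrow>\<^sub>E X"
  shows "inverses X \<alpha> = (\<Union>B\<in>transversals X \<alpha>. left_inverses X B \<alpha>)"
proof (intro equalityI subsetI)
  fix \<beta> assume "\<beta> \<in> inverses X \<alpha>"
  then have \<beta>: "\<beta> \<in> X \<rightarrow>\<^sub>E X" "\<And>x. x \<in> X \<Longrightarrow> \<alpha> (\<beta> (\<alpha> x)) = \<alpha> x"
      "\<And>x. x \<in> X \<Longrightarrow> \<beta> (\<alpha> (\<beta> x)) = \<beta> x"
    by (auto simp: inverse_of_transformations_iff)
  have "inj_on \<alpha> (\<beta> ` X)" using \<beta>(3) by (intro inj_on_inverseI[where g = \<beta>]) auto
  moreover have "\<alpha> ` \<beta> ` X = \<alpha> ` X"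
  proof
    show "\<alpha> ` \<beta> ` X \<subseteq> \<alpha> ` X" using \<beta>(1) by auto
    show "\<alpha> ` X \<subseteq> \<alpha> ` \<beta> ` X"
    proof
      fix y assume "y \<in> \<alpha> ` X"
      then obtain x where x: "x \<in> X" "y = \<alpha> x" by blast
      then have "y = \<alpha> (\<beta> (\<alpha> x))" "\<alpha> x \<in> X" using \<beta>(2) assms by auto
      then show "y \<in> \<alpha> ` \<beta> ` X" by blast
    qed
  qed
  ultimately have "\<beta> ` X \<in> transversals X \<alpha>"
    using \<beta>(1) by (auto simp: transversals_def bij_betw_def)
  moreover have "\<beta> \<in> left_inverses X (\<beta> ` X) \<alpha>"
    using \<beta> by (auto simp: left_inverses_def PiE_iff)
  ultimately show "\<beta> \<in> (\<Union>B\<in>transversals X \<alpha>. left_inverses X B \<alpha>)" by blast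
next
  fix \<beta> assume "\<beta> \<in> (\<Union>B\<in>transversals X \<alpha>. left_inverses X B \<alpha>)"
  then obtain B where B: "B \<subseteq> X" "\<alpha> ` B = \<alpha> ` X"
    and \<beta>: "\<beta> \<in> X \<rightarrow>\<^sub>E B" "\<And>b. b \<in> B \<Longrightarrow> \<beta> (\<alpha> b) = b"
    by (auto simp: transversals_def left_inverses_def bij_betw_def)
  have "\<alpha> (\<beta> (\<alpha> x)) = \<alpha> x" if "x \<in> X" for x
  proof -
    have "\<alpha> x \<in> \<alpha> ` B" using that B(2) by simp
    then obtain b where "b \<in> B" "\<alpha> x = \<alpha> b" by blast
    then show ?thesis using \<beta>(2) by simp
  qed
  moreover have "\<beta> (\<alpha> (\<beta> x)) = \<beta> x" if "x \<in> X" for x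
    using that \<beta> by auto
  moreover have "\<beta> \<in> X \<rightarrow>\<^sub>E X" using \<beta>(1) B(1) by (auto simp: PiE_iff)
  ultimately show "\<beta> \<in> inverses X \<alpha>"
    using assms by (simp add: inverse_of_transformations_iff)
qed

lemma inverses_nonempty:
  assumes "\<alpha> \<in> X \<rightarrow>\<^sub>E X"
  shows "inverses X \<alpha> \<noteq> {}"
proof -
  obtain B where B: "B \<in> transversals X \<alpha>" using transversals_nonempty by blast
  then have "B \<subseteq> X" and bij: "bij_betw \<alpha> B (\<alpha> ` X)" by (auto simp: transversals_def)
  define \<beta> where "\<beta> = (\<lambda>x\<in>X. inv_into B \<alpha> (if x \<in> \<alpha> ` X then x else \<alpha> x))"
  have "\<beta> \<in> X \<rightarrow>\<^sub>E B"
    using bij unfolding \<beta>_def by (auto simp: bij_betw_def intro!: inv_into_into)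
  moreover have "\<beta> (\<alpha> b) = b" if "b \<in> B" for b
    using that bij \<open>B \<subseteq> X\<close> assms by (auto simp: \<beta>_def bij_betw_def)
  ultimately have "\<beta> \<in> left_inverses X B \<alpha>" by (simp add: left_inverses_def)
  with B show ?thesis using inverses_eq_UN_left_inverses[OF assms] by blast
qed

text \<open>The image of \<open>\<beta>\<close> is a transversal of \<open>\<alpha>\<close>, hence
  in bijection with the image of \<open>\<alpha>\<close>.\<close>

lemma card_image_inverse:
  assumes "inverse_of (X \<rightarrow>\<^sub>E X) (compose X) \<beta> \<alpha>"
  shows "card (\<beta> ` X) = card (\<alpha> ` X)"
proof -
  have \<alpha>: "\<alpha> \<in> X \<rightarrow>\<^sub>E X" using assms by (simp add: inverse_of_def)
  obtain B where B: "B \<in> transversals X \<alpha>" "\<beta> \<in> left_inverses X B \<alpha>"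
    using assms inverses_eq_UN_left_inverses[OF \<alpha>] by blast
  then have "\<beta> ` X = B"
    using \<alpha> by (intro image_left_inverse) (auto simp: transversals_def)
  with B(1) show ?thesis by (auto simp: transversals_def dest: bij_betw_same_card)
qed

section \<open>Weights\<close>

text \<open>As \<open>\<tau>\<close> is injective on the image of \<open>\<beta>\<close>, the
  permutation \<open>\<sigma>\<close> carries the kernel classes of \<open>\<beta>\<close> onto
  those of \<open>\<gamma>\<close>, and so transversals onto transversals.\<close>

lemma card_transversals_transport:
  assumes \<sigma>: "bij_betw \<sigma> X X" and \<tau>: "inj_on \<tau> (\<beta> ` X)"
    and eq: "\<And>x. x \<in> X \<Longrightarrow> \<gamma> (\<sigma> x) = \<tau> (\<beta> x)"
  shows "card (transversals X \<gamma>) = card (transversals X \<beta>)"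
proof -
  have inj: "inj_on \<sigma> X" and im: "\<sigma> ` X = X" using \<sigma> by (auto simp: bij_betw_def)
  have im_eq: "\<gamma> ` \<sigma> ` B = \<tau> ` \<beta> ` B" if "B \<subseteq> X" for B
    using eq that by (force simp: image_iff)
  have key: "\<sigma> ` B \<in> transversals X \<gamma> \<longleftrightarrow> B \<in> transversals X \<beta>" if B: "B \<subseteq> X" for B
  proof -
    have "inj_on \<gamma> (\<sigma> ` B) \<longleftrightarrow> inj_on (\<gamma> \<circ> \<sigma>) B"
      using inj B by (meson comp_inj_on inj_on_imageI inj_on_subset)
    also have "\<dots> \<longleftrightarrow> inj_on (\<tau> \<circ> \<beta>) B"
      using eq B by (intro inj_on_cong) auto
    also have "\<dots> \<longleftrightarrow> inj_on \<beta> B"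
      using \<tau> B by (meson comp_inj_on image_mono inj_on_imageI2 inj_on_subset)
    finally have 1: "inj_on \<gamma> (\<sigma> ` B) \<longleftrightarrow> inj_on \<beta> B" .
    have "\<gamma> ` \<sigma> ` B = \<gamma> ` X \<longleftrightarrow> \<tau> ` \<beta> ` B = \<tau> ` \<beta> ` X"
      using im_eq[OF B] im_eq[of X] im by simp
    also have "\<dots> \<longleftrightarrow> \<beta> ` B = \<beta> ` X"
      using \<tau> B by (intro inj_on_image_eq_iff) auto
    finally have 2: "\<gamma> ` \<sigma> ` B = \<gamma> ` X \<longleftrightarrow> \<beta> ` B = \<beta> ` X" .
    have "\<sigma> ` B \<subseteq> X" using B im by blast
    with B 1 2 show ?thesis by (simp add: transversals_def bij_betw_def)
  qed
  have "transversals X \<gamma> = image \<sigma> ` transversals X \<beta>"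
  proof (intro equalityI subsetI)
    fix C assume C: "C \<in> transversals X \<gamma>"
    then have "C \<subseteq> \<sigma> ` X" using im by (simp add: transversals_def)
    then obtain B where "B \<subseteq> X" "C = \<sigma> ` B" by (auto simp: subset_image_iff)
    with C key show "C \<in> image \<sigma> ` transversals X \<beta>" by blast
  qed (use key in \<open>auto simp: transversals_def\<close>)
  moreover have "inj_on (image \<sigma>) (transversals X \<beta>)"
    using inj by (intro inj_on_subset[OF inj_on_image_Pow]) (auto simp: transversals_def)
  ultimately show ?thesis by (simp add: card_image)
qed

text \<open>In a finite set, equinumerous subsets have equinumerous complements, and any bijection
  between the complements completes \<open>h\<close>.\<close>

lemma bij_betw_extend:
  assumes "finite X" "A \<subseteq> X" "B \<subseteq> X" "bij_betw h A B"
  obtains \<sigma> where "bij_betw \<sigma> X X" "\<And>a. a \<in> A \<Longrightarrow> \<sigma> a = h a"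
proof -
  have fin: "finite A" "finite B" using assms finite_subset by blast+
  have "card (X - A) = card (X - B)"
    using assms fin bij_betw_same_card[OF assms(4)] by (simp add: card_Diff_subset)
  then obtain g where g: "bij_betw g (X - A) (X - B)"
    using assms(1) by (meson finite_Diff finite_same_card_bij)
  let ?\<sigma> = "\<lambda>x. if x \<in> A then h x else g x"
  have "bij_betw ?\<sigma> (A \<union> (X - A)) (B \<union> (X - B))"
  proof (rule bij_betw_combine)
    show "bij_betw ?\<sigma> A B" using assms(4) by (simp cong: bij_betw_cong)
    show "bij_betw ?\<sigma> (X - A) (X - B)"
      using g by (rule bij_betw_cong[THEN iffD1, rotated]) auto
  qed auto
  moreover have "A \<union> (X - A) = X" "B \<union> (X - B) = X" using assms by auto
  ultimately show ?thesis by (intro that[of ?\<sigma>]) auto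
qed

text \<open>The new map is \<tau> \<beta> \<sigma>^-1: \<open>\<sigma>\<close> moves the points
  where values are prescribed, and \<open>\<tau>\<close> renames the values to match.\<close>

lemma left_inverses_transport:
  assumes \<sigma>: "bij_betw \<sigma> X X" and \<tau>: "bij_betw \<tau> B B'"
    and "\<psi> ` B \<subseteq> X" and eq: "\<And>b. b \<in> B \<Longrightarrow> \<sigma> (\<psi> b) = \<psi>' (\<tau> b)"
    and \<beta>: "\<beta> \<in> left_inverses X B \<psi>"
  shows "(\<lambda>x\<in>X. \<tau> (\<beta> (inv_into X \<sigma> x))) \<in> left_inverses X B' \<psi>'" (is "?\<gamma> \<in> _")
proof -
  have inv: "inv_into X \<sigma> x \<in> X" if "x \<in> X" for x
    using that \<sigma> by (metis bij_betw_def inv_into_into)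
  have "?\<gamma> \<in> X \<rightarrow>\<^sub>E B'"
    using inv \<beta> \<tau> by (auto simp: left_inverses_def bij_betw_def)
  moreover have "?\<gamma> (\<psi>' c) = c" if "c \<in> B'" for c
  proof -
    have "c \<in> \<tau> ` B" using that \<tau> by (simp add: bij_betw_def)
    then obtain b where b: "b \<in> B" "c = \<tau> b" by blast
    then have "\<psi> b \<in> X" using assms(3) by auto
    moreover have "\<psi>' c = \<sigma> (\<psi> b)" using b eq by simp
    ultimately show ?thesis
      using \<sigma> b \<beta> by (auto simp: bij_betw_def left_inverses_def)
  qed
  ultimately show ?thesis by (simp add: left_inverses_def)
qed

text \<open>The transport \<beta> to \<tau> \<beta> \<sigma>^-1 is a bijection between the two index
  sets and preserves the number of transversals, so the sums agree term by term.\<close>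

lemma sum_left_inverses_eq:
  fixes F :: "nat \<Rightarrow> real"
  assumes fin: "finite X" and sub: "B \<subseteq> X" "B' \<subseteq> X" and card: "card B = card B'"
    and \<psi>: "inj_on \<psi> B" "\<psi> ` B \<subseteq> X" and \<psi>': "inj_on \<psi>' B'" "\<psi>' ` B' \<subseteq> X"
  shows "(\<Sum>\<beta>\<in>left_inverses X B \<psi>. F (card (transversals X \<beta>))) =
         (\<Sum>\<beta>\<in>left_inverses X B' \<psi>'. F (card (transversals X \<beta>)))"
proof -
  obtain \<tau> where \<tau>: "bij_betw \<tau> B B'"
    using fin sub card by (meson finite_same_card_bij finite_subset)
  have "bij_betw (\<psi>' \<circ> (\<tau> \<circ> inv_into B \<psi>)) (\<psi> ` B) (\<psi>' ` B')"
    using \<tau> \<psi>(1) \<psi>'(1)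
    by (intro bij_betw_trans[where B = B'] bij_betw_trans[where B = B])
      (auto simp: bij_betw_def inj_on_inv_into)
  then obtain \<sigma> where \<sigma>: "bij_betw \<sigma> X X"
    and "\<And>a. a \<in> \<psi> ` B \<Longrightarrow> \<sigma> a = (\<psi>' \<circ> (\<tau> \<circ> inv_into B \<psi>)) a"
    using bij_betw_extend[OF fin \<psi>(2) \<psi>'(2)] by metis
  then have eq: "\<sigma> (\<psi> b) = \<psi>' (\<tau> b)" if "b \<in> B" for b using that \<psi>(1) by simp
  let ?\<sigma>' = "inv_into X \<sigma>" and ?\<tau>' = "inv_into B \<tau>"
  have \<sigma>': "bij_betw ?\<sigma>' X X" and \<tau>': "bij_betw ?\<tau>' B' B"
    using \<sigma> \<tau> by (auto intro: bij_betw_inv_into)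
  have \<sigma>\<sigma>: "?\<sigma>' (\<sigma> x) = x" "\<sigma> (?\<sigma>' x) = x" "\<sigma> x \<in> X" "?\<sigma>' x \<in> X" "inv_into X ?\<sigma>' x = \<sigma> x"
    if "x \<in> X" for x
    using that \<sigma> \<sigma>' by (auto simp: bij_betw_inv_into_left bij_betw_inv_into_right
        bij_betw_apply inv_into_inv_into_eq)
  have eq': "?\<sigma>' (\<psi>' c) = \<psi> (?\<tau>' c)" if "c \<in> B'" for c
  proof -
    have "?\<tau>' c \<in> B" "\<tau> (?\<tau>' c) = c"
      using that \<tau> \<tau>' by (auto simp: bij_betw_inv_into_right bij_betw_apply)
    then have "\<psi>' c = \<sigma> (\<psi> (?\<tau>' c))" "\<psi> (?\<tau>' c) \<in> X" using eq \<psi>(2) by auto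
    then show ?thesis using \<sigma>\<sigma> by simp
  qed
  \<comment> \<open>\<open>?j\<close> keeps \<open>inv_into X ?\<sigma>'\<close> in place of
    \<open>\<sigma>\<close> so that it is literally the transport along the inverse
    bijections.\<close>
  let ?i = "\<lambda>\<beta>. \<lambda>x\<in>X. \<tau> (\<beta> (?\<sigma>' x))" and ?j = "\<lambda>\<beta>. \<lambda>x\<in>X. ?\<tau>' (\<beta> (inv_into X ?\<sigma>' x))"
  have ji: "?j (?i \<beta>) = \<beta>" if "\<beta> \<in> left_inverses X B \<psi>" for \<beta>
  proof
    fix x
    show "?j (?i \<beta>) x = \<beta> x"
      using that \<sigma>\<sigma> \<tau>
      by (cases "x \<in> X") (auto simp: left_inverses_def PiE_iff extensional_def bij_betw_inv_into_left)
  qed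
  have ij: "?i (?j \<beta>) = \<beta>" if "\<beta> \<in> left_inverses X B' \<psi>'" for \<beta>
  proof
    fix x
    show "?i (?j \<beta>) x = \<beta> x"
      using that \<sigma>\<sigma> \<tau>
      by (cases "x \<in> X") (auto simp: left_inverses_def PiE_iff extensional_def bij_betw_inv_into_right)
  qed
  show ?thesis
  proof (rule sum.reindex_bij_witness[where i = ?j and j = ?i])
    fix \<beta> assume \<beta>: "\<beta> \<in> left_inverses X B \<psi>"
    show "?j (?i \<beta>) = \<beta>" using \<beta> by (rule ji)
    show "?i \<beta> \<in> left_inverses X B' \<psi>'"
      using \<sigma> \<tau> \<psi>(2) eq \<beta> by (rule left_inverses_transport)
    have "card (transversals X (?i \<beta>)) = card (transversals X \<beta>)"
      using \<sigma> \<tau> \<sigma>\<sigma> image_left_inverse[OF \<psi>(2) \<beta>]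
      by (intro card_transversals_transport[where \<sigma> = \<sigma> and \<tau> = \<tau>]) (auto simp: bij_betw_def)
    then show "F (card (transversals X (?i \<beta>))) = F (card (transversals X \<beta>))" by simp
  next
    fix \<beta> assume \<beta>: "\<beta> \<in> left_inverses X B' \<psi>'"
    show "?i (?j \<beta>) = \<beta>" using \<beta> by (rule ij)
    show "?j \<beta> \<in> left_inverses X B \<psi>"
      using \<sigma>' \<tau>' \<psi>'(2) eq' \<beta> by (rule left_inverses_transport)
  qed
qed

section \<open>Row sums of the weights\<close>

definition weight :: "'a set \<Rightarrow> ('a \<Rightarrow> 'a) \<Rightarrow> ('a \<Rightarrow> 'a) \<Rightarrow> real" where
  "weight X \<alpha> \<beta> = 1 / (real (card (transversals X \<alpha>)) * real (card (transversals X \<beta>)))"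

lemma weight_pos: "finite X \<Longrightarrow> 0 < weight X \<alpha> \<beta>"
  by (simp add: weight_def card_transversals_pos)

lemma weight_commute: "weight X \<alpha> \<beta> = weight X \<beta> \<alpha>"
  by (simp add: weight_def mult.commute)

lemma finite_inverses: "finite X \<Longrightarrow> finite (inverses X \<alpha>)"
  by (rule finite_subset[of _ "X \<rightarrow>\<^sub>E X"]) (auto simp: inverse_of_def finite_PiE)

text \<open>The inverses of \<open>\<alpha>\<close> split into one block per transversal, and every
  block has the same sum \<open>?s\<close>. The factor for \<open>\<alpha>\<close> in the weight
  cancels the number of blocks, leaving an expression that involves \<open>\<alpha>\<close> only
  through its rank.\<close>

lemma sum_weight_inverses:
  assumes fin: "finite X" and \<alpha>: "\<alpha> \<in> X \<rightarrow>\<^sub>E X" and B: "B \<subseteq> X" "card B = card (\<alpha> ` X)"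
    and \<psi>: "inj_on \<psi> B" "\<psi> ` B \<subseteq> X"
  shows "(\<Sum>\<beta>\<in>inverses X \<alpha>. weight X \<alpha> \<beta>) =
         (\<Sum>\<beta>\<in>left_inverses X B \<psi>. 1 / real (card (transversals X \<beta>)))"
    (is "_ = ?s")
proof -
  let ?p = "\<lambda>\<alpha>. real (card (transversals X \<alpha>))"
  have trans: "C \<subseteq> X" "inj_on \<alpha> C" "\<alpha> ` C \<subseteq> X" "card C = card (\<alpha> ` X)"
    if "C \<in> transversals X \<alpha>" for C
    using that \<alpha> bij_betw_same_card by (auto simp: transversals_def bij_betw_def)
  have "(\<Sum>\<beta>\<in>inverses X \<alpha>. 1 / ?p \<beta>) =
      (\<Sum>C\<in>transversals X \<alpha>. \<Sum>\<beta>\<in>left_inverses X C \<alpha>. 1 / ?p \<beta>)"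
    unfolding inverses_eq_UN_left_inverses[OF \<alpha>]
  proof (rule sum.UNION_disjoint)
    show "\<forall>C\<in>transversals X \<alpha>. finite (left_inverses X C \<alpha>)"
    proof
      fix C assume "C \<in> transversals X \<alpha>"
      then have "finite C" using fin trans(1) finite_subset by blast
      then show "finite (left_inverses X C \<alpha>)"
        using fin by (simp add: left_inverses_def finite_PiE)
    qed
    show "\<forall>C\<in>transversals X \<alpha>. \<forall>D\<in>transversals X \<alpha>. C \<noteq> D \<longrightarrow>
        left_inverses X C \<alpha> \<inter> left_inverses X D \<alpha> = {}"
    proof (intro ballI impI)
      fix C D assume C: "C \<in> transversals X \<alpha>" and D: "D \<in> transversals X \<alpha>" and "C \<noteq> D"
      have "C = D" if "\<beta> \<in> left_inverses X C \<alpha>" "\<beta> \<in> left_inverses X D \<alpha>" for \<beta>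
        using image_left_inverse[OF trans(3)[OF C] that(1)] image_left_inverse[OF trans(3)[OF D] that(2)]
        by simp
      with \<open>C \<noteq> D\<close> show "left_inverses X C \<alpha> \<inter> left_inverses X D \<alpha> = {}" by blast
    qed
  qed (simp add: finite_transversals fin)
  also have "\<dots> = (\<Sum>C\<in>transversals X \<alpha>. ?s)"
    using fin B \<psi> trans
    by (intro sum.cong refl sum_left_inverses_eq[where F = "\<lambda>k. 1 / real k"]) auto
  also have "\<dots> = ?p \<alpha> * ?s" by simp
  finally have "(\<Sum>\<beta>\<in>inverses X \<alpha>. 1 / ?p \<beta>) / ?p \<alpha> = ?s"
    using card_transversals_pos[OF fin, of \<alpha>] by simp
  then show ?thesis by (simp add: weight_def sum_divide_distrib mult.commute)
qed

lemma sum_weight_inverses_eq: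
  assumes "finite X" "\<alpha> \<in> X \<rightarrow>\<^sub>E X" "\<beta> \<in> X \<rightarrow>\<^sub>E X" "card (\<beta> ` X) = card (\<alpha> ` X)"
  shows "(\<Sum>\<gamma>\<in>inverses X \<beta>. weight X \<beta> \<gamma>) = (\<Sum>\<gamma>\<in>inverses X \<alpha>. weight X \<alpha> \<gamma>)"
  using assms by (subst (1 2) sum_weight_inverses[where B = "\<alpha> ` X" and \<psi> = id]) auto

lemma full_transformations_permutation_matching:
  assumes fin: "finite X"
  shows "\<exists>f. permutation_matching (X \<rightarrow>\<^sub>E X) (compose X) f"
proof -
  let ?S = "X \<rightarrow>\<^sub>E X"
  define R where "R \<alpha> = (\<Sum>\<beta>\<in>inverses X \<alpha>. weight X \<alpha> \<beta>)" for \<alpha>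
  \<comment> \<open>Dividing by the row sum of \<open>\<alpha>\<close> alone still gives a symmetric
    matrix, because \<open>R\<close> agrees on mutually inverse maps. Column sums then reduce to row
    sums.\<close>
  define w where "w \<alpha> \<beta> = (if \<beta> \<in> inverses X \<alpha> then weight X \<alpha> \<beta> / R \<alpha> else 0)" for \<alpha> \<beta>
  have R_pos: "0 < R \<alpha>" if "\<alpha> \<in> ?S" for \<alpha>
    unfolding R_def using fin inverses_nonempty[OF that]
    by (intro sum_pos finite_inverses weight_pos) auto
  have R_eq: "R \<beta> = R \<alpha>" if "\<beta> \<in> inverses X \<alpha>" for \<alpha> \<beta>
    unfolding R_def using that fin card_image_inverse
    by (intro sum_weight_inverses_eq) (auto simp: inverse_of_def)
  have w_sym: "w \<beta> \<alpha> = w \<alpha> \<beta>" for \<alpha> \<beta>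
    using R_eq[of \<beta> \<alpha>] inverse_of_commute[of ?S "compose X" \<alpha> \<beta>] weight_commute[of X \<alpha> \<beta>]
    by (simp add: w_def)
  have row: "(\<Sum>\<beta>\<in>?S. w \<alpha> \<beta>) = 1" if "\<alpha> \<in> ?S" for \<alpha>
  proof -
    have "(\<Sum>\<beta>\<in>?S. w \<alpha> \<beta>) = (\<Sum>\<beta>\<in>inverses X \<alpha>. weight X \<alpha> \<beta> / R \<alpha>)"
      using fin by (intro sum.mono_neutral_cong_right finite_PiE) (auto simp: w_def inverse_of_def)
    also have "\<dots> = 1" using R_pos[OF that] by (simp add: R_def flip: sum_divide_distrib)
    finally show ?thesis .
  qed
  have "\<exists>f. bij_betw f ?S ?S \<and> (\<forall>\<alpha>\<in>?S. w \<alpha> (f \<alpha>) \<noteq> 0)"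
  proof (rule doubly_stochastic_imp_permutation)
    show "finite ?S" using fin by (intro finite_PiE) auto
    show "0 \<le> w \<alpha> \<beta>" if "\<alpha> \<in> ?S" "\<beta> \<in> ?S" for \<alpha> \<beta>
      using R_pos[OF that(1)] weight_pos[OF fin, of \<alpha> \<beta>] by (simp add: w_def)
    show "(\<Sum>\<beta>\<in>?S. w \<alpha> \<beta>) = 1" if "\<alpha> \<in> ?S" for \<alpha> using that by (rule row)
    show "(\<Sum>\<alpha>\<in>?S. w \<alpha> \<beta>) = 1" if "\<beta> \<in> ?S" for \<beta> using row[OF that] by (simp add: w_sym)
  qed
  \<comment> \<open>A nonzero entry of \<open>w\<close> can only sit at a pair of mutually inverse
    maps.\<close>
  then show ?thesis by (auto simp: permutation_matching_def w_def split: if_splits)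
qed

theorem theorem2p12:
  fixes n :: nat
  assumes "n \<ge> 1"
  shows "\<exists>f. permutation_matching (full_transformations n) (transformation_mult n) f"
  unfolding full_transformations_def transformation_mult_def
  by (rule full_transformations_permutation_matching) simp

end
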